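(* Let $0<\alpha<1$, let $x>0$ be fixed, and let $y$ be a sufficiently differentiable function on $[0,x]$ (i.e. $y\in C^r[0,x]$ for some sufficiently large $r$). For an integer $n\ge 2$ put $h=x/n$. Then, as $n\to\infty$ (equivalently $h\to 0$), $$y^{(\alpha)}(x)=\frac{1}{\Gamma(2-\alpha)h^\alpha}\sum_{k=0}^n \delta_k^{(\alpha)}\, y(x-kh)+O\left(h^{2}\right).$$
   Context: The Caputo derivative of order $\alpha\in(0,1)$ is $y^{(\alpha)}(x)=\frac{1}{\Gamma(1-\alpha)}\int_0^x \frac{y'(\xi)}{(x-\xi)^{\alpha}}\,d\xi$. For a given integer $n\ge 2$ define $\sigma_0^{(\alpha)}=1$, $\sigma_n^{(\alpha)}=(n-1)^{1-\alpha}-n^{1-\alpha}$, and $\sigma_k^{(\alpha)}=(k-1)^{1-\alpha}-2k^{1-\alpha}+(k+1)^{1-\alpha}$ for $1\le k\le n-1$. Define $\delta_0^{(\alpha)}=\sigma_0^{(\alpha)}-\zeta(\alpha-1)$, $\delta_1^{(\alpha)}=\sigma_1^{(\alpha)}+2\zeta(\alpha-1)$, $\delta_2^{(\alpha)}=\sigma_2^{(\alpha)}-\zeta(\alpha-1)$, and $\delta_k^{(\alpha)}=\sigma_k^{(\alpha)}$ for $3\le k\le n$, where $\zeta$ is the Riemann zeta function (analytically continued). *)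

theory Defs
  imports "HOL-Complex_Analysis.Complex_Analysis" "HOL-Library.Landau_Symbols"
begin

definition riemann_zeta :: "complex \<Rightarrow> complex" where
  "riemann_zeta s = (THE z. \<exists>f. f holomorphic_on (- {1}) \<and>
      (\<forall>w. 1 < Re w \<longrightarrow> f w = (\<Sum>m. inverse (of_nat (Suc m) powr w))) \<and> f s = z)"

definition zeta_real :: "real \<Rightarrow> real" where
  "zeta_real a = Re (riemann_zeta (complex_of_real a))"

definition Ck_on :: "nat \<Rightarrow> real set \<Rightarrow> (real \<Rightarrow> real) \<Rightarrow> bool" where
  "Ck_on r S y \<longleftrightarrow> (\<exists>D :: nat \<Rightarrow> real \<Rightarrow> real. D 0 = y \<and>
      (\<forall>k<r. \<forall>t\<in>S. (D k has_real_derivative D (Suc k) t) (at t within S)) \<and>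
      (\<forall>k\<le>r. continuous_on S (D k)))"

definition caputo :: "real \<Rightarrow> (real \<Rightarrow> real) \<Rightarrow> real \<Rightarrow> real" where
  "caputo \<alpha> y x = (1 / Gamma (1 - \<alpha>)) *
      integral {0..x} (\<lambda>\<xi>. vector_derivative y (at \<xi> within {0..x}) / (x - \<xi>) powr \<alpha>)"

definition sigma_coef :: "real \<Rightarrow> nat \<Rightarrow> nat \<Rightarrow> real" where
  "sigma_coef \<alpha> n k =
     (if k = 0 then 1
      else if k = n then (real n - 1) powr (1 - \<alpha>) - (real n) powr (1 - \<alpha>)
      else (real k - 1) powr (1 - \<alpha>) - 2 * (real k) powr (1 - \<alpha>) + (real k + 1) powr (1 - \<alpha>))"

definition delta_coef :: "real \<Rightarrow> nat \<Rightarrow> nat \<Rightarrow> real" where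
  "delta_coef \<alpha> n k =
     (if k = 0 then sigma_coef \<alpha> n 0 - zeta_real (\<alpha> - 1)
      else if k = 1 then sigma_coef \<alpha> n 1 + 2 * zeta_real (\<alpha> - 1)
      else if k = 2 then sigma_coef \<alpha> n 2 - zeta_real (\<alpha> - 1)
      else sigma_coef \<alpha> n k)"

end

theory Submission
  imports Defs
begin

text \<open>
  Summation by parts turns \<open>h\<^sup>-\<^sup>\<alpha> \<Sum> \<sigma>\<^sub>k y(x - kh)\<close> into the integral
  \<open>(1 - \<alpha>) \<integral> t\<^sup>-\<^sup>\<alpha> p(t) dt\<close>, \<open>p(t) = y'(x - t)\<close>, in which the weight \<open>t\<^sup>-\<^sup>\<alpha>\<close> is replaced by its mean on
  each mesh interval. Write \<open>p(t) = y'(x) - y''(x) t + r(t)\<close> with \<open>r'(t) = O(t)\<close>. The constant is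
  integrated exactly. On the linear part the error is
  \<open>h\<^sup>2\<^sup>-\<^sup>\<alpha>\<close> times the error of the trapezoidal rule for \<open>\<Sum> k\<^sup>1\<^sup>-\<^sup>\<alpha>\<close>, which tends to \<open>\<zeta>(\<alpha> - 1)\<close> at
  rate \<open>n\<^sup>-\<^sup>\<alpha>\<close>; the correction in the \<open>\<delta>\<^sub>k\<close> is a second difference cancelling exactly this
  term. On \<open>r\<close> the oscillation over \<open>[kh, (k+1)h]\<close> is \<open>O((k+1) h\<^sup>2)\<close>, small enough near the
  singularity for the errors to add up to \<open>O(h\<^sup>2)\<close>.
\<close>

section \<open>Analytic continuation of the zeta function\<close>

text \<open>With \<open>N = n + 1\<close> this is \<open>- (N powr (-w))\<close> times the remainder
  of the degree \<open>M\<close> Taylor polynomial of \<open>(1 + u) powr (-w)\<close> at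
  \<open>u = 1/N\<close>. Summed over \<open>n\<close>, the difference telescopes and the other
  terms become zeta series at \<open>w + j\<close>.\<close>

definition binom_rem :: "nat \<Rightarrow> complex \<Rightarrow> nat \<Rightarrow> complex" where
  "binom_rem M w n = of_nat (Suc n) powr (-w) - of_nat (Suc (Suc n)) powr (-w)
     + (\<Sum>j=1..M. ((-w) gchoose j) * of_nat (Suc n) powr (-w - of_nat j))"

text \<open>Taylor's theorem along the segment from 0 to 1. The constant depends on \<open>w\<close>
  only through \<open>B\<close>, so the estimate is uniform on bounded sets, as the M-test below
  requires.\<close>

lemma binomial_taylor_bound:
  fixes w :: complex
  assumes "norm w \<le> B" "0 \<le> u" "u \<le> 1"
  shows "norm ((1 + of_real u) powr (-w) - (\<Sum>j\<le>M. ((-w) gchoose j) * of_real u ^ j))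
           \<le> ((\<Prod>j<Suc M. B + real j) * 2 powr B / fact M) * u ^ Suc M"
proof -
  define f where "f i z = (\<Prod>j<i. - w - of_nat j) * (1 + z) powr (-w - of_nat i)" for i and z :: complex
  define S where "S = closed_segment (0::complex) 1"
  have S: "\<exists>t. z = of_real t \<and> 0 \<le> t \<and> t \<le> 1" if "z \<in> S" for z
    using that by (auto simp: S_def closed_segment_def scaleR_conv_of_real)
  have mem: "of_real u \<in> S" "0 \<in> S"
    using assms by (auto simp: S_def closed_segment_def scaleR_conv_of_real)
  have "norm (f 0 (of_real u) - (\<Sum>i\<le>M. f i 0 * (of_real u - 0) ^ i / fact i))
      \<le> ((\<Prod>j<Suc M. B + real j) * 2 powr B) * norm (complex_of_real u - 0) ^ Suc M / fact M"
  proof (rule complex_Taylor[of S])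
    show "convex S" by (simp add: S_def)
  next
    fix i z assume "z \<in> S" "i \<le> M"
    then obtain t where t: "z = of_real t" "0 \<le> t" "t \<le> 1" using S by blast
    have "1 + z = of_real (1 + t)" by (simp add: t)
    \<comment> \<open>The segment stays off the branch cut of \<open>powr\<close>.\<close>
    hence nz: "1 + z \<notin> \<real>\<^sub>\<le>\<^sub>0" using t(2) by (metis add_pos_nonneg complex_nonpos_Reals_iff Re_complex_of_real not_le zero_less_one)
    have "((\<lambda>z. (1 + z) powr (-w - of_nat i)) has_field_derivative
        (-w - of_nat i) * (1 + z) powr (-w - of_nat i - 1)) (at z)"
      using DERIV_chain2[where g = "\<lambda>z. 1 + z", OF has_field_derivative_powr[OF nz]
          DERIV_add[OF DERIV_const DERIV_ident]] by simp
    thus "(f i has_field_derivative f (Suc i) z) (at z within S)"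
      unfolding f_def
      by (intro DERIV_cong[OF has_field_derivative_at_within[OF DERIV_cmult]]) (auto simp: algebra_simps)
  next
    fix z assume "z \<in> S"
    then obtain t where t: "z = of_real t" "0 \<le> t" "t \<le> 1" using S by blast
    have "norm (\<Prod>j<Suc M. - w - of_nat j) \<le> (\<Prod>j<Suc M. B + real j)"
      unfolding prod_norm[symmetric]
    proof (rule prod_mono)
      fix j show "0 \<le> cmod (- w - of_nat j) \<and> cmod (- w - of_nat j) \<le> B + real j"
        using norm_triangle_ineq4[of "-w" "of_nat j"] assms(1) by simp
    qed
    moreover have "norm ((1 + z) powr (-w - of_nat (Suc M))) \<le> 2 powr B"
    proof -
      have "1 + z = of_real (1 + t)" by (simp add: t)
      hence "norm ((1 + z) powr (-w - of_nat (Suc M))) = (1 + t) powr (- Re w - Suc M)"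
        using t by (subst norm_powr_real_powr) auto
      \<comment> \<open>The base is at least 1 and \<open>- Re w \<le> norm w \<le> B\<close>, so
        the exponent can be raised to \<open>B\<close> whatever the sign of
        \<open>Re w\<close>.\<close>
      also have "\<dots> \<le> (1 + t) powr B"
        using abs_Re_le_cmod[of w] assms t by (intro powr_mono) auto
      also have "\<dots> \<le> 2 powr B"
        using t norm_ge_zero[of w] assms(1) by (intro powr_mono2) linarith+
      finally show ?thesis .
    qed
    ultimately show "cmod (f (Suc M) z) \<le> (\<Prod>j<Suc M. B + real j) * 2 powr B"
      unfolding f_def norm_mult by (intro mult_mono) (auto intro: order_trans[OF norm_ge_zero])
  qed (use mem in auto)
  moreover have "f 0 (of_real u) = (1 + of_real u) powr (-w)" by (simp add: f_def)
  moreover have "f i 0 * (of_real u - 0) ^ i / fact i = ((-w) gchoose i) * of_real u ^ i" for i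
    by (simp add: f_def gbinomial_prod_rev atLeast0LessThan)
  ultimately show ?thesis using assms(2) by (simp add: norm_power)
qed

lemma binom_rem_bound:
  "\<exists>C\<ge>0. \<forall>w n. norm w \<le> B \<longrightarrow>
     norm (binom_rem M w n) \<le> C * real (Suc n) powr (- Re w - real M - 1)"
\<comment> \<open>For negative \<open>B\<close> the estimate is vacuous but the Taylor constant may
  be negative; the absolute value secures \<open>C \<ge> 0\<close> without a case split.\<close>
proof (intro exI[of _ "\<bar>(\<Prod>j<Suc M. B + real j) * 2 powr B / fact M\<bar>"] conjI allI impI)
  let ?C = "(\<Prod>j<Suc M. B + real j) * 2 powr B / fact M"
  fix w :: complex and n :: nat assume B: "norm w \<le> B"
  define N where "N = real (Suc n)"
  have N: "N \<ge> 1" by (simp add: N_def)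
  have "N * (1 + 1/N) = real (Suc (Suc n))"
    using N by (simp add: N_def distrib_left)
  hence N1: "of_nat (Suc n) = complex_of_real N" "of_nat (Suc (Suc n)) = complex_of_real (N * (1 + 1/N))"
    unfolding N_def of_real_of_nat_eq by simp_all
  have a: "complex_of_real (N * (1 + 1/N)) powr (-w) = of_real N powr (-w) * (1 + of_real (1/N)) powr (-w)"
    using N by (subst of_real_mult, subst powr_times_real) auto
  have b: "complex_of_real N powr (-w - of_nat j) = of_real N powr (-w) * of_real (1/N) ^ j" for j
    using N by (simp add: powr_diff power_divide divide_simps)
  have "binom_rem M w n = - (of_real N powr (-w)) *
     ((1 + of_real (1/N)) powr (-w) - (\<Sum>j\<le>M. ((-w) gchoose j) * of_real (1/N) ^ j))"
    unfolding binom_rem_def N1 a b atMost_atLeast0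
    by (subst sum.atLeast_Suc_atMost[of 0]) (simp_all add: algebra_simps sum_distrib_left sum_negf)
  also have "norm \<dots> = N powr (- Re w) *
     norm ((1 + of_real (1/N)) powr (-w) - (\<Sum>j\<le>M. ((-w) gchoose j) * of_real (1/N) ^ j))"
    using N by (simp add: norm_mult norm_powr_real_powr)
  also have "\<dots> \<le> N powr (- Re w) * (?C * (1/N) ^ Suc M)"
    using N by (intro mult_left_mono binomial_taylor_bound B) auto
  also have "\<dots> \<le> N powr (- Re w) * (\<bar>?C\<bar> * (1/N) ^ Suc M)"
    using N by (intro mult_left_mono mult_right_mono abs_ge_self) auto
  also have "(1/N) ^ Suc M = N powr (- real M - 1)"
    using N by (simp add: powr_realpow power_divide powr_diff powr_minus divide_simps)
  also have "N powr (- Re w) * (\<bar>?C\<bar> * N powr (- real M - 1)) = \<bar>?C\<bar> * N powr (- Re w - real M - 1)"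
    by (simp add: algebra_simps flip: powr_add)
  finally show "norm (binom_rem M w n) \<le> \<bar>?C\<bar> * real (Suc n) powr (- Re w - real M - 1)"
    by (simp add: N_def)
qed auto

lemma summable_Suc_powr: "summable (\<lambda>n. real (Suc n) powr s) \<longleftrightarrow> s < -1"
  using summable_Suc_iff[of "\<lambda>n. real n powr s"] by (simp add: summable_real_powr_iff)

lemma holomorphic_gbinomial [holomorphic_intros]:
  "f holomorphic_on A \<Longrightarrow> (\<lambda>s. f s gchoose k) holomorphic_on A"
  unfolding gbinomial_prod_rev by (intro holomorphic_intros) auto

text \<open>The terms are O(\<open>n powr (- Re w - M - 1)\<close>), uniformly for bounded
  \<open>w\<close>, and on this half-plane the exponent is below -1. Hence the partial sums converge
  locally uniformly.\<close>

lemma holomorphic_suminf_binom_rem: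
  "(\<lambda>w. \<Sum>n. binom_rem M w n) holomorphic_on {w. - real M < Re w}"
proof (rule holomorphic_uniform_sequence[where f = "\<lambda>k w. \<Sum>n<k. binom_rem M w n"])
  show "open {w. - real M < Re w}" by (rule open_halfspace_Re_gt)
  show "(\<lambda>w. \<Sum>n<k. binom_rem M w n) holomorphic_on {w. - real M < Re w}" for k
    unfolding binom_rem_def by (intro holomorphic_intros)
  fix z assume z: "z \<in> {w. - real M < Re w}"
  \<comment> \<open>Half the distance from \<open>z\<close> to the boundary line: on the closed ball
    \<open>Re w \<ge> d - M\<close>, so the terms are dominated by a multiple of
    \<open>(n + 1) powr (-d - 1)\<close>.\<close>
  define d where "d = (Re z + real M) / 2"
  have d: "d > 0" using z by (simp add: d_def)
  have Re: "Re w \<ge> d - real M" if "w \<in> cball z d" for w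
    using that abs_Re_le_cmod[of "z - w"] by (auto simp: dist_norm d_def field_simps)
  have nm: "norm w \<le> norm z + d" if "w \<in> cball z d" for w
    using that norm_triangle_ineq2[of w z] by (simp add: dist_norm norm_minus_commute)
  obtain C where "C \<ge> 0" and C: "\<And>w n. norm w \<le> norm z + d \<Longrightarrow>
      norm (binom_rem M w n) \<le> C * real (Suc n) powr (- Re w - real M - 1)"
    using binom_rem_bound[of "norm z + d" M] by blast
  have "uniform_limit (cball z d) (\<lambda>k w. \<Sum>n<k. binom_rem M w n) (\<lambda>w. \<Sum>n. binom_rem M w n) sequentially"
  proof (rule Weierstrass_m_test)
    fix n w assume w: "w \<in> cball z d"
    have "norm (binom_rem M w n) \<le> C * real (Suc n) powr (- Re w - real M - 1)"
      by (rule C[OF nm[OF w]])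
    also have "\<dots> \<le> C * real (Suc n) powr (-d - 1)"
      using Re[OF w] \<open>C \<ge> 0\<close> by (intro mult_left_mono powr_mono) auto
    finally show "norm (binom_rem M w n) \<le> C * real (Suc n) powr (-d - 1)" .
  next
    show "summable (\<lambda>n. C * real (Suc n) powr (-d - 1))"
      using d by (intro summable_mult) (simp add: summable_Suc_powr del: of_nat_Suc)
  qed
  moreover have "cball z d \<subseteq> {w. - real M < Re w}" using Re d by force
  ultimately show "\<exists>d>0. cball z d \<subseteq> {w. - real M < Re w} \<and>
      uniform_limit (cball z d) (\<lambda>k w. \<Sum>n<k. binom_rem M w n) (\<lambda>w. \<Sum>n. binom_rem M w n) sequentially"
    using d by blast
qed

text \<open>Expanding \<open>n\<^sup>-\<^sup>w - (n+1)\<^sup>-\<^sup>w\<close> at \<open>w = s - 1\<close> to \<open>m\<close> terms and summing over \<open>n\<close>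
  expresses \<open>(s - 1) \<zeta>(s)\<close> through its values at \<open>s + 1, s + 2, \<dots>\<close>; read as a definition,
  this extends \<open>(s - 1) \<zeta>(s)\<close> from \<open>Re s > 2 - m\<close> to \<open>Re s > 1 - m\<close>.\<close>

primrec zeta_reg :: "nat \<Rightarrow> complex \<Rightarrow> complex" where
  "zeta_reg 0 s = 0"
| "zeta_reg (Suc m) s = 1 - (\<Sum>j=2..Suc m. ((1 - s) gchoose (j - 1)) / of_nat j * zeta_reg m (s - 1 + of_nat j))
      - (\<Sum>n. binom_rem (Suc m) (s - 1) n)"

text \<open>Since \<open>j \<ge> 2\<close>, the arguments \<open>s - 1 + j\<close> lie at least one
  unit to the right of \<open>s\<close>, so each recursion step gains a strip of width one. The
  remainder series at \<open>s - 1\<close> is holomorphic on exactly the enlarged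
  half-plane.\<close>

lemma holomorphic_zeta_reg: "m \<ge> 1 \<Longrightarrow> zeta_reg m holomorphic_on {s. 1 - real m < Re s}"
proof (induction m)
  case (Suc m)
  let ?S = "{s. 1 - real (Suc m) < Re s}"
  have "(\<lambda>s. zeta_reg m (s - 1 + of_nat j)) holomorphic_on ?S" if "j \<in> {2..Suc m}" for j
  proof -
    \<comment> \<open>For \<open>m = 0\<close> the range of \<open>j\<close> is empty, so the
      induction hypothesis is only called where it applies.\<close>
    have "m \<ge> 1" using that by auto
    hence "zeta_reg m holomorphic_on {s. 1 - real m < Re s}" by (rule Suc.IH)
    moreover have "(\<lambda>s. s - 1 + of_nat j) ` ?S \<subseteq> {s. 1 - real m < Re s}" using that by auto
    ultimately show ?thesis
      by (intro holomorphic_on_compose_gen[of "\<lambda>s. s - 1 + of_nat j" ?S "zeta_reg m", unfolded o_def]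
            holomorphic_intros)
  qed
  moreover have "(\<lambda>s. \<Sum>n. binom_rem (Suc m) (s - 1) n) holomorphic_on ?S"
    by (rule holomorphic_on_compose_gen[OF _ holomorphic_suminf_binom_rem, unfolded o_def])
      (auto intro!: holomorphic_intros)
  ultimately have "(\<lambda>s. 1 - (\<Sum>j=2..Suc m. ((1 - s) gchoose (j - 1)) / of_nat j * zeta_reg m (s - 1 + of_nat j))
      - (\<Sum>n. binom_rem (Suc m) (s - 1) n)) holomorphic_on ?S"
    by (intro holomorphic_intros) auto
  thus ?case by simp
qed simp

lemma sums_telescope_powr:
  assumes "0 < Re w"
  shows "(\<lambda>n. of_nat (Suc n) powr (-w) - of_nat (Suc (Suc n)) powr (-w)) sums (1 :: complex)"
proof -
  have "(\<lambda>n. complex_of_real (real (Suc n)) powr (-w)) \<longlonglongrightarrow> 0"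
  proof (rule tendsto_norm_zero_cancel)
    have "(\<lambda>n. real (Suc n) powr (- Re w)) \<longlonglongrightarrow> 0"
      using assms by (intro tendsto_neg_powr filterlim_compose[OF filterlim_real_sequentially filterlim_Suc]) auto
    thus "(\<lambda>n. norm (complex_of_real (real (Suc n)) powr (-w))) \<longlonglongrightarrow> 0"
      by (subst norm_powr_real_powr) auto
  qed
  from telescope_sums'[OF this] show ?thesis by simp
qed

lemma zeta_summable: "1 < Re s \<Longrightarrow> summable (\<lambda>n. of_nat (Suc n) powr (-s) :: complex)"
proof (rule summable_norm_cancel)
  assume "1 < Re s"
  hence "summable (\<lambda>n. real (Suc n) powr (- Re s))"
    by (simp add: summable_Suc_powr del: of_nat_Suc)
  thus "summable (\<lambda>n. norm (of_nat (Suc n) powr (-s) :: complex))"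
    by (subst norm_powr_real_powr) auto
qed

text \<open>For \<open>Re s > 1\<close> all series converge and the expansion may be summed
  termwise. The term \<open>j = 1\<close> yields \<open>- (s - 1) * Z s\<close>, the quantity to be
  solved for; the terms from \<open>j = 2\<close> on are rewritten by the induction
  hypothesis.\<close>

lemma zeta_reg_eq:
  "m \<ge> 1 \<Longrightarrow> 1 < Re s \<Longrightarrow> zeta_reg m s = (s - 1) * (\<Sum>n. of_nat (Suc n) powr (-s))"
proof (induction m arbitrary: s)
  case (Suc m)
  define Z where "Z s = (\<Sum>n. of_nat (Suc n) powr (-s) :: complex)" for s
  have "(\<lambda>n. binom_rem (Suc m) (s - 1) n) sums
      (1 + (\<Sum>j=1..Suc m. ((-(s-1)) gchoose j) * Z (s - 1 + of_nat j)))"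
    unfolding binom_rem_def
  proof (intro sums_add sums_telescope_powr sums_sum sums_mult)
    fix j assume "j \<in> {1..Suc m}"
    hence "1 < Re (s - 1 + of_nat j)" using Suc.prems by simp
    from summable_sums[OF zeta_summable[OF this]]
    show "(\<lambda>n. of_nat (Suc n) powr (- (s - 1) - of_nat j)) sums Z (s - 1 + of_nat j)"
      by (simp add: Z_def algebra_simps)
  qed (use Suc.prems in simp)
  hence "(\<Sum>n. binom_rem (Suc m) (s - 1) n) =
      1 + (\<Sum>j=1..Suc m. ((-(s-1)) gchoose j) * Z (s - 1 + of_nat j))"
    by (rule sums_unique[symmetric])
  also have "\<dots> = 1 - (s - 1) * Z s + (\<Sum>j=2..Suc m. ((-(s-1)) gchoose j) * Z (s - 1 + of_nat j))"
    by (subst sum.atLeast_Suc_atMost) (simp_all add: numeral_2_eq_2 algebra_simps)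
  also have "(\<Sum>j=2..Suc m. ((-(s-1)) gchoose j) * Z (s - 1 + of_nat j)) =
     - (\<Sum>j=2..Suc m. ((1 - s) gchoose (j - 1)) / of_nat j * zeta_reg m (s - 1 + of_nat j))"
    unfolding sum_negf[symmetric]
  proof (rule sum.cong[OF refl])
    fix j assume j: "j \<in> {2..Suc m}"
    then obtain i where i: "j = Suc i" by (cases j) auto
    have a: "zeta_reg m (s - 1 + of_nat j) = (s - 1 + of_nat i) * Z (s - 1 + of_nat j)"
      unfolding Z_def using j Suc.prems by (subst Suc.IH) (auto simp: i)
    \<comment> \<open>The last factor \<open>1 - s - i\<close> of the binomial coefficient is, up to
      sign, the factor that turns \<open>Z\<close> into \<open>zeta_reg\<close> at
      \<open>s - 1 + j\<close>.\<close>
    have b: "(-(s-1)) gchoose j = ((1 - s) gchoose i) * (1 - s - of_nat i) / of_nat j"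
      using gbinomial_mult_1[of "1 - s" i]
      by (simp add: i divide_simps del: of_nat_Suc) (simp add: algebra_simps)
    have "j - 1 = i" by (simp add: i)
    thus "((-(s-1)) gchoose j) * Z (s - 1 + of_nat j) =
        - (((1 - s) gchoose (j - 1)) / of_nat j * zeta_reg m (s - 1 + of_nat j))"
      unfolding a b using j by (simp add: field_simps)
  qed
  finally show ?case by (simp add: Z_def)
qed simp

section \<open>Gluing the half-planes and identification with the zeta function\<close>

lemma zeta_reg_agree:
  assumes "1 \<le> m" "m \<le> m'" "1 - real m < Re s"
  shows "zeta_reg m s = zeta_reg m' s"
proof (rule analytic_continuation_open[of "{s. 1 < Re s}" "{s. 1 - real m < Re s}" "zeta_reg m" "zeta_reg m'"])
  show "{s. 1 < Re s} \<noteq> {}" by (auto intro!: exI[of _ 2])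
  show "connected {s. 1 - real m < Re s}" by (intro convex_connected convex_halfspace_Re_gt)
  show "zeta_reg m' holomorphic_on {s. 1 - real m < Re s}"
    by (rule holomorphic_on_subset[OF holomorphic_zeta_reg]) (use assms in auto)
qed (use assms in \<open>auto intro: holomorphic_zeta_reg open_halfspace_Re_gt simp: zeta_reg_eq\<close>)

text \<open>The index is one whose half-plane contains \<open>s\<close>. It varies with
  \<open>s\<close>, so holomorphy is obtained by passing to a fixed index on each
  half-plane.\<close>

definition zeta_cont :: "complex \<Rightarrow> complex" where
  "zeta_cont s = zeta_reg (nat \<lceil>\<bar>Re s\<bar>\<rceil> + 2) s / (s - 1)"

lemma zeta_cont_eq:
  assumes "1 \<le> m" "1 - real m < Re s"
  shows "zeta_cont s = zeta_reg m s / (s - 1)"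
proof -
  define k where "k = nat \<lceil>\<bar>Re s\<bar>\<rceil> + 2"
  have "1 \<le> k" "1 - real k < Re s" unfolding k_def by linarith+
  hence "zeta_reg k s = zeta_reg m s"
    using assms by (metis zeta_reg_agree linear)
  thus ?thesis by (simp add: zeta_cont_def k_def)
qed

lemma holomorphic_zeta_cont: "zeta_cont holomorphic_on (- {1})"
proof -
  have "zeta_cont holomorphic_on (\<Union>m\<in>{1..}. {s. 1 - real m < Re s} - {1})"
  proof (rule holomorphic_on_UN_open)
    fix m :: nat assume m: "m \<in> {1..}"
    have "(\<lambda>s. zeta_reg m s / (s - 1)) holomorphic_on {s. 1 - real m < Re s} - {1}"
      using m by (intro holomorphic_intros holomorphic_on_subset[OF holomorphic_zeta_reg]) auto
    thus "zeta_cont holomorphic_on {s. 1 - real m < Re s} - {1}"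
      by (rule holomorphic_transform) (use m zeta_cont_eq in auto)
    show "open ({s. 1 - real m < Re s} - {1})"
      by (intro open_delete open_halfspace_Re_gt)
  qed
  moreover have "(\<Union>m\<in>{1..}. {s. 1 - real m < Re s} - {1}) = - {1::complex}"
  proof (intro equalityI subsetI)
    fix s :: complex assume s: "s \<in> - {1}"
    have "1 - real (nat \<lceil>\<bar>Re s\<bar>\<rceil> + 2) < Re s" by linarith
    with s show "s \<in> (\<Union>m\<in>{1..}. {s. 1 - real m < Re s} - {1})"
      by (intro UN_I[of "nat \<lceil>\<bar>Re s\<bar>\<rceil> + 2"]) auto
  qed auto
  ultimately show ?thesis by simp
qed

text \<open>\<open>zeta_cont\<close> witnesses existence for the definite description. Uniqueness is
  the identity theorem on the punctured plane, which is connected.\<close>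

theorem riemann_zeta_eq_zeta_reg:
  assumes "1 \<le> m" "1 - real m < Re s" "s \<noteq> 1"
  shows "riemann_zeta s = zeta_reg m s / (s - 1)"
proof -
  have series: "zeta_cont w = (\<Sum>m. inverse (of_nat (Suc m) powr w))" if "1 < Re w" for w
  proof -
    have "w \<noteq> 1" using that by auto
    moreover have "zeta_cont w = zeta_reg 1 w / (w - 1)" using that by (intro zeta_cont_eq) auto
    moreover have "zeta_reg 1 w = (w - 1) * (\<Sum>n. of_nat (Suc n) powr (-w))"
      using that by (intro zeta_reg_eq) auto
    ultimately show ?thesis by (simp add: powr_minus del: of_nat_Suc)
  qed
  have "riemann_zeta s = zeta_cont s"
    unfolding riemann_zeta_def
  proof (rule the_equality)
    show "\<exists>f. f holomorphic_on - {1} \<and> (\<forall>w. 1 < Re w \<longrightarrow> f w = (\<Sum>m. inverse (of_nat (Suc m) powr w)))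
            \<and> f s = zeta_cont s"
      using holomorphic_zeta_cont series by blast
  next
    fix z assume "\<exists>f. f holomorphic_on - {1} \<and> (\<forall>w. 1 < Re w \<longrightarrow> f w = (\<Sum>m. inverse (of_nat (Suc m) powr w)))
            \<and> f s = z"
    then obtain f where f: "f holomorphic_on - {1}" "f s = z"
      "\<And>w. 1 < Re w \<Longrightarrow> f w = (\<Sum>m. inverse (of_nat (Suc m) powr w))" by blast
    have "f s = zeta_cont s"
    proof (rule analytic_continuation_open[of "{s. 1 < Re s}" "- {1}" f zeta_cont])
      show "{s. 1 < Re s} \<noteq> {}" by (auto intro!: exI[of _ 2])
      show "connected (- {1::complex})" by (intro connected_punctured_universe) simp
    qed (use f series holomorphic_zeta_cont assms in \<open>auto intro: open_halfspace_Re_gt\<close>)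
    thus "z = zeta_cont s" using f(2) by simp
  qed
  with zeta_cont_eq[OF assms(1,2)] show ?thesis by simp
qed

section \<open>Sums of powers\<close>

lemma powr_mvt:
  fixes a b c :: real
  assumes "0 < a" "a < b"
  shows "\<exists>z>a. z < b \<and> b powr c - a powr c = (b - a) * (c * z powr (c - 1))"
  using assms by (intro MVT2 has_real_derivative_powr) auto

text \<open>Each term is dominated by a multiple of the difference of consecutive values of
  \<open>N powr (-p)\<close>, and the tail of these differences telescopes.\<close>

lemma sum_tail_bound:
  fixes a :: "nat \<Rightarrow> complex"
  assumes "0 < p" and a: "\<And>n. norm (a n) \<le> C * real (Suc n) powr (- 1 - p)"
  shows "norm (suminf a - (\<Sum>n<N. a n)) \<le> C * (2 powr (1 + p) / p) * real (Suc N) powr (- p)"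
proof -
  have "0 \<le> C" using order_trans[OF norm_ge_zero a[of 0]] by simp
  define b where "b n = C * (2 powr (1 + p) / p) * (real (Suc n) powr (-p) - real (Suc (Suc n)) powr (-p))" for n
  have "norm (a n) \<le> b n" for n
  proof -
    obtain z where z: "real (Suc n) < z" "z < real (Suc (Suc n))"
      "real (Suc (Suc n)) powr (-p) - real (Suc n) powr (-p) =
         (real (Suc (Suc n)) - real (Suc n)) * (-p * z powr (- p - 1))"
      using powr_mvt[of "real (Suc n)" "real (Suc (Suc n))" "-p"] of_nat_0_less_iff of_nat_less_iff lessI zero_less_Suc
      by blast
    have "2 powr (1 + p) * 2 powr (- 1 - p) = (1 :: real)"
      by (simp flip: powr_add)
    \<comment> \<open>The factor \<open>2 powr (1 + p)\<close> pays for replacing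
      \<open>n + 1\<close> by the intermediate point \<open>z\<close>, which is at most
      \<open>2 * (n + 1)\<close>.\<close>
    hence "real (Suc n) powr (- 1 - p) = 2 powr (1 + p) * (2 * real (Suc n)) powr (- 1 - p)"
      by (simp only: powr_mult mult.assoc[symmetric] mult_1_left)
    also have "\<dots> \<le> 2 powr (1 + p) * z powr (- 1 - p)"
      using z(1,2) \<open>0 < p\<close> by (intro mult_left_mono powr_mono2') auto
    also have "\<dots> = 2 powr (1 + p) / p * (real (Suc n) powr (-p) - real (Suc (Suc n)) powr (-p))"
    proof -
      have e: "- 1 - p = - p - 1" by simp
      have "real (Suc n) powr (-p) - real (Suc (Suc n)) powr (-p) = p * z powr (- 1 - p)"
        unfolding e using z(3) by simp
      thus ?thesis using \<open>0 < p\<close> by simp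
    qed
    finally have "real (Suc n) powr (- 1 - p)
        \<le> 2 powr (1 + p) / p * (real (Suc n) powr (-p) - real (Suc (Suc n)) powr (-p))" .
    from mult_left_mono[OF this \<open>0 \<le> C\<close>] a[of n] show ?thesis by (simp add: b_def)
  qed
  hence ab: "norm (a (n + N)) \<le> b (n + N)" for n by blast
  have "(\<lambda>n. real (Suc (n + N)) powr (-p)) \<longlonglongrightarrow> 0"
    using \<open>0 < p\<close> filterlim_compose[OF filterlim_real_sequentially filterlim_add_const_nat_at_top[of "Suc N"]]
    by (intro tendsto_neg_powr) auto
  from telescope_sums'[OF this]
  have b: "(\<lambda>n. b (n + N)) sums (C * (2 powr (1 + p) / p) * real (Suc N) powr (-p))"
    unfolding b_def by (intro sums_mult) simp
  have sm: "summable (\<lambda>n. norm (a (n + N)))"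
    using ab by (intro summable_comparison_test[OF _ sums_summable[OF b]]) auto
  hence "summable a" using summable_iff_shift[of a N] summable_norm_cancel[OF sm] by simp
  hence "norm (suminf a - (\<Sum>n<N. a n)) = norm (\<Sum>n. a (n + N))"
    by (simp add: suminf_minus_initial_segment)
  also have "\<dots> \<le> (\<Sum>n. norm (a (n + N)))" by (rule summable_norm[OF sm])
  also have "\<dots> \<le> (\<Sum>n. b (n + N))" by (rule suminf_le[OF ab sm sums_summable[OF b]])
  finally show ?thesis using sums_unique[OF b] by (simp only:)
qed

lemma binom_rem_1:
  "binom_rem 1 w n = of_nat (Suc n) powr (-w) - of_nat (Suc (Suc n)) powr (-w)
     - w * of_nat (Suc n) powr (-w - 1)"
  by (simp add: binom_rem_def)

lemma binom_rem_2:
  "binom_rem 2 w n = of_nat (Suc n) powr (-w) - of_nat (Suc (Suc n)) powr (-w)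
     - w * of_nat (Suc n) powr (-w - 1) + w * (w + 1) / 2 * of_nat (Suc n) powr (-w - 2)"
  by (simp add: binom_rem_def numeral_2_eq_2 gbinomial_prod_rev) (simp add: field_simps)

text \<open>The first two stages of the zeta recursion give asymptotic relations for the sums of
  \<open>k powr (\<beta> - 1)\<close> and \<open>k powr \<beta>\<close>. Both remainders decay like
  \<open>n powr (\<beta> - 2)\<close>, so their tails are O(\<open>n powr (\<beta> - 1)\<close>).
  Eliminating the sum of \<open>k powr (\<beta> - 1)\<close> leaves the claim.\<close>

theorem sum_powr_zeta:
  assumes "0 < \<beta>" "\<beta> < 1"
  shows "\<exists>C. \<forall>n\<ge>1. \<bar>(\<Sum>k<n. real k powr \<beta>)
           - (real n powr (1 + \<beta>) / (1 + \<beta>) - real n powr \<beta> / 2 + zeta_real (- \<beta>))\<bar>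
         \<le> C * real n powr (\<beta> - 1)"
proof -
  define a1 where "a1 = binom_rem 1 (of_real (-\<beta>))"
  define a2 where "a2 = binom_rem 2 (of_real (-\<beta>) - 1)"
  define Z1 where "Z1 = zeta_reg 1 (1 + of_real (-\<beta>))"
  define Z2 where "Z2 = zeta_reg 2 (of_real (-\<beta>))"
  have bnd: "\<exists>C. \<forall>n. norm (binom_rem M (of_real c) n) \<le> C * real (Suc n) powr (- c - real M - 1)" for M c
    using binom_rem_bound[of "norm (of_real c :: complex)" M] by fastforce
  obtain C1 where C1: "norm (a1 n) \<le> C1 * real (Suc n) powr (- 1 - (1 - \<beta>))" for n
  proof -
    have "- (-\<beta>) - real 1 - 1 = - 1 - (1 - \<beta>)" by simp
    with bnd[of 1 "-\<beta>"] show ?thesis using that unfolding a1_def by metis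
  qed
  obtain C2 where C2: "norm (a2 n) \<le> C2 * real (Suc n) powr (- 1 - (1 - \<beta>))" for n
  proof -
    have "- (-\<beta>-1) - real 2 - 1 = - 1 - (1 - \<beta>)" "complex_of_real (-\<beta>) - 1 = of_real (-\<beta>-1)" by simp_all
    with bnd[of 2 "-\<beta>-1"] show ?thesis using that unfolding a2_def by metis
  qed
  \<comment> \<open>The recursion for \<open>zeta_reg\<close> at \<open>1 - \<beta>\<close> and at
    \<open>- \<beta>\<close>, solved for the remainder series. In the second one the only shifted
    argument is again \<open>1 - \<beta>\<close>.\<close>
  have s1: "suminf a1 = 1 - Z1" by (simp add: a1_def Z1_def)
  have s2: "suminf a2 = 1 - of_real ((1 + \<beta>) / 2) * Z1 - Z2"
    by (simp add: a2_def Z2_def Z1_def numeral_2_eq_2 field_simps)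
  have zeta: "of_real (1 + \<beta>) * riemann_zeta (of_real (-\<beta>)) = - Z2"
  proof -
    \<comment> \<open>Two is the least index whose half-plane \<open>Re s > 1 - m\<close> contains
      \<open>- \<beta>\<close> for every \<beta> in (0,1).\<close>
    have "riemann_zeta (of_real (-\<beta>)) = Z2 / (of_real (-\<beta>) - 1)"
      unfolding Z2_def using assms by (intro riemann_zeta_eq_zeta_reg) (simp_all only: of_real_eq_1_iff, simp_all)
    also have "complex_of_real (-\<beta>) - 1 = - of_real (1 + \<beta>)" by simp
    finally have "riemann_zeta (of_real (-\<beta>)) = - (Z2 / of_real (1 + \<beta>))" by (simp only: divide_minus_right)
    moreover have "complex_of_real (1 + \<beta>) \<noteq> 0" using assms by (simp only: of_real_eq_0_iff)
    ultimately show ?thesis by (simp del: of_real_add of_real_minus)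
  qed
  define K where "K = 2 powr (1 + (1 - \<beta>)) / (1 - \<beta>)"
  have "\<bar>(\<Sum>k<n. real k powr \<beta>)
           - (real n powr (1 + \<beta>) / (1 + \<beta>) - real n powr \<beta> / 2 + zeta_real (- \<beta>))\<bar>
         \<le> ((C2 * K + (1 + \<beta>) / 2 * (C1 * K)) / (1 + \<beta>)) * real n powr (\<beta> - 1)" if "n \<ge> 1" for n
  proof -
    obtain N where n: "n = Suc N" using \<open>n \<ge> 1\<close> by (cases n) auto
    define S1 where "S1 = (\<Sum>i<N. real (Suc i) powr (\<beta> - 1))"
    define S2 where "S2 = (\<Sum>i<N. real (Suc i) powr \<beta>)"
    \<comment> \<open>The term at \<open>k = 0\<close> vanishes because
      \<open>0 powr \<beta> = 0\<close>.\<close>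
    have S2: "(\<Sum>k<n. real k powr \<beta>) = S2"
      unfolding n sum.lessThan_Suc_shift S2_def by simp
    have tele: "(\<Sum>i<N. real (Suc i) powr c - real (Suc (Suc i)) powr c) = 1 - real n powr c" for c
      using sum_lessThan_telescope'[of "\<lambda>i. real (Suc i) powr c" N] by (simp add: n)
    have powr: "of_nat k powr of_real c = complex_of_real (real k powr c)" for k c
      using powr_of_real[of "real k" c] by simp
    have a1: "a1 i = of_real ((real (Suc i) powr \<beta> - real (Suc (Suc i)) powr \<beta>) + \<beta> * real (Suc i) powr (\<beta> - 1))" for i
    proof -
      have "- complex_of_real (-\<beta>) = of_real \<beta>" "complex_of_real \<beta> - 1 = of_real (\<beta> - 1)" by simp_all
      thus ?thesis unfolding a1_def binom_rem_1 by (simp only: powr) simp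
    qed
    have t1: "(\<Sum>i<N. a1 i) = of_real ((1 - real n powr \<beta>) + \<beta> * S1)"
      unfolding S1_def tele[symmetric] a1 of_real_sum[symmetric] of_real_eq_iff by (simp add: sum.distrib sum_distrib_left del: of_nat_Suc)
    have a2: "a2 i = of_real ((real (Suc i) powr (1+\<beta>) - real (Suc (Suc i)) powr (1+\<beta>))
        + ((1+\<beta>) * real (Suc i) powr \<beta> + (1+\<beta>) * \<beta> / 2 * real (Suc i) powr (\<beta> - 1)))" for i
    proof -
      have "- (complex_of_real (-\<beta>) - 1) = of_real (1 + \<beta>)"
        "complex_of_real (1 + \<beta>) - 1 = of_real \<beta>" "complex_of_real (1 + \<beta>) - 2 = of_real (\<beta> - 1)"
        by simp_all
      moreover have "(complex_of_real (-\<beta>) - 1) * ((complex_of_real (-\<beta>) - 1) + 1) / 2 = of_real ((1+\<beta>) * \<beta> / 2)"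
        by (simp add: algebra_simps)
      ultimately show ?thesis unfolding a2_def binom_rem_2 by (simp only: powr) (simp add: algebra_simps)
    qed
    have t2: "(\<Sum>i<N. a2 i) = of_real ((1 - real n powr (1+\<beta>)) + ((1 + \<beta>) * S2 + (1+\<beta>) * \<beta> / 2 * S1))"
      unfolding S1_def S2_def tele[symmetric] a2 of_real_sum[symmetric] of_real_eq_iff by (simp add: sum.distrib sum_distrib_left del: of_nat_Suc)
    define e1 where "e1 = Re (suminf a1 - (\<Sum>i<N. a1 i))"
    define e2 where "e2 = Re (suminf a2 - (\<Sum>i<N. a2 i))"
    have e1: "\<bar>e1\<bar> \<le> C1 * K * real n powr (\<beta> - 1)"
      unfolding e1_def K_def n using sum_tail_bound[OF _ C1, of N] assms
      by (intro order_trans[OF abs_Re_le_cmod]) simp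
    have e2: "\<bar>e2\<bar> \<le> C2 * K * real n powr (\<beta> - 1)"
      unfolding e2_def K_def n using sum_tail_bound[OF _ C2, of N] assms
      by (intro order_trans[OF abs_Re_le_cmod]) simp
    have zr: "(1 + \<beta>) * zeta_real (-\<beta>) = - Re Z2"
      using arg_cong[OF zeta, of Re] by (simp add: zeta_real_def del: of_real_add of_real_minus)
    have E1: "e1 = real n powr \<beta> - Re Z1 - \<beta> * S1"
      unfolding e1_def s1 t1 by simp
    have E2: "e2 = real n powr (1 + \<beta>) - (1 + \<beta>) / 2 * Re Z1 - Re Z2 - ((1 + \<beta>) * S2 + (1 + \<beta>) * \<beta> / 2 * S1)"
      unfolding e2_def s2 t2 by (simp del: of_real_add of_real_divide)
    define E where "E = (\<Sum>k<n. real k powr \<beta>)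
           - (real n powr (1 + \<beta>) / (1 + \<beta>) - real n powr \<beta> / 2 + zeta_real (- \<beta>))"
    have "(1 + \<beta>) * (real n powr (1 + \<beta>) / (1 + \<beta>)) = real n powr (1 + \<beta>)"
      using assms by simp
    \<comment> \<open>This combination cancels both \<open>S1\<close> and \<open>Re Z1\<close>; the
      surviving constant \<open>Re Z2\<close> is \<open>- (1 + \<beta>)\<close> times the zeta
      value.\<close>
    hence "(1 + \<beta>) * E = (1 + \<beta>) / 2 * e1 - e2"
      unfolding E_def S2 E1 E2 right_diff_distrib distrib_left[of "1 + \<beta>"] zr by (simp add: field_simps)
    hence "(1 + \<beta>) * \<bar>E\<bar> = \<bar>(1 + \<beta>) / 2 * e1 - e2\<bar>"
      using assms abs_mult[of "1 + \<beta>" E] by simp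
    also have "\<dots> \<le> (1 + \<beta>) / 2 * \<bar>e1\<bar> + \<bar>e2\<bar>"
      using assms abs_triangle_ineq4[of "(1 + \<beta>) / 2 * e1" e2] by (simp add: abs_mult)
    also have "\<dots> \<le> (1 + \<beta>) / 2 * (C1 * K * real n powr (\<beta> - 1)) + C2 * K * real n powr (\<beta> - 1)"
      using assms by (intro add_mono mult_left_mono e1 e2) auto
    finally have "(1 + \<beta>) * \<bar>E\<bar> \<le> (C2 * K + (1 + \<beta>) / 2 * (C1 * K)) * real n powr (\<beta> - 1)"
      by (simp only: distrib_right mult.assoc add.commute)
    hence "\<bar>E\<bar> \<le> (C2 * K + (1 + \<beta>) / 2 * (C1 * K)) * real n powr (\<beta> - 1) / (1 + \<beta>)"
      using assms by (simp only: pos_le_divide_eq mult.commute)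
    thus ?thesis unfolding E_def by (simp only: times_divide_eq_left)
  qed
  thus ?thesis by blast
qed

section \<open>Error of the piecewise constant weight\<close>

lemma has_integral_powr_weight:
  fixes \<alpha> a b c0 c1 :: real
  assumes "0 < \<alpha>" "\<alpha> < 1" "0 \<le> a" "a \<le> b"
  shows "((\<lambda>t. t powr (-\<alpha>) * (c0 + c1 * t)) has_integral
           (c0 * (b powr (1-\<alpha>) - a powr (1-\<alpha>)) / (1-\<alpha>)
            + c1 * (b powr (2-\<alpha>) - a powr (2-\<alpha>)) / (2-\<alpha>))) {a..b}"
proof -
  define F where "F t = c0 * t powr (1-\<alpha>) / (1-\<alpha>) + c1 * t powr (2-\<alpha>) / (2-\<alpha>)" for t
  have "((\<lambda>t. t powr (-\<alpha>) * (c0 + c1 * t)) has_integral (F b - F a)) {a..b}"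
  \<comment> \<open>The interior version admits \<open>a = 0\<close>, where the antiderivative is
    continuous but not differentiable in general.\<close>
  proof (rule fundamental_theorem_of_calculus_interior)
    show "continuous_on {a..b} F"
      unfolding F_def using assms by (intro continuous_intros continuous_on_powr') auto
  next
    fix t assume "t \<in> {a<..<b}"
    hence "t > 0" using assms by simp
    have "(F has_real_derivative
        c0 * ((1-\<alpha>) * t powr (1-\<alpha>-1)) / (1-\<alpha>) + c1 * ((2-\<alpha>) * t powr (2-\<alpha>-1)) / (2-\<alpha>)) (at t)"
      unfolding F_def using \<open>t > 0\<close>
      by (intro DERIV_add DERIV_cdivide DERIV_cmult has_real_derivative_powr)
    moreover have "t powr (2-\<alpha>-1) = t powr (-\<alpha>) * t"
      using \<open>t > 0\<close> powr_add[of t "-\<alpha>" 1] by (simp add: algebra_simps)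
    moreover have "1 - \<alpha> \<noteq> 0" "2 - \<alpha> \<noteq> 0" using assms by auto
    ultimately have "(F has_real_derivative t powr (-\<alpha>) * (c0 + c1 * t)) (at t)"
      by (simp add: distrib_left mult_ac)
    thus "(F has_vector_derivative t powr (-\<alpha>) * (c0 + c1 * t)) (at t)"
      by (simp add: has_real_derivative_iff_has_vector_derivative)
  qed fact
  thus ?thesis by (simp add: F_def right_diff_distrib diff_divide_distrib algebra_simps)
qed

text \<open>The weight is non-negative and integrable, hence absolutely integrable, and
  \<open>r\<close> is bounded and measurable.\<close>

lemma integrable_powr_weight:
  fixes r :: "real \<Rightarrow> real"
  assumes "0 < \<alpha>" "\<alpha> < 1" "0 \<le> a" "a \<le> b" "continuous_on {a..b} r"
  shows "(\<lambda>t. t powr (-\<alpha>) * r t) integrable_on {a..b}"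
proof -
  have "(\<lambda>t. r t * t powr (-\<alpha>)) absolutely_integrable_on {a..b}"
  proof (rule absolutely_integrable_bounded_measurable_product_real)
    show "r \<in> borel_measurable (lebesgue_on {a..b})"
      by (rule continuous_imp_measurable_on_sets_lebesgue) (use assms in auto)
    show "bounded (r ` {a..b})"
      using assms by (intro compact_imp_bounded compact_continuous_image) auto
    have "(\<lambda>t. t powr (-\<alpha>)) integrable_on {a..b}"
      using has_integral_powr_weight[of \<alpha> a b 1 0] assms by auto
    thus "(\<lambda>t. t powr (-\<alpha>)) absolutely_integrable_on {a..b}"
      by (rule nonnegative_absolutely_integrable_1) simp
  qed simp
  thus ?thesis by (simp add: absolutely_integrable_on_def mult.commute)
qed

text \<open>Since \<open>r\<close> minus its mean integrates to zero, the weight may be replaced by its excess over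
  \<open>b\<^sup>-\<^sup>\<alpha>\<close>, which has a sign; so the interval touching the singularity needs no separate estimate.
  In the proof \<open>g\<close> is patched at the origin, where \<open>0 powr (-\<alpha>) = 0\<close>.\<close>

lemma weighted_mean_error:
  fixes r :: "real \<Rightarrow> real"
  assumes \<alpha>: "0 < \<alpha>" "\<alpha> < 1" and ab: "0 \<le> a" "a < b" and r: "continuous_on {a..b} r"
    and osc: "\<And>s t. s \<in> {a..b} \<Longrightarrow> t \<in> {a..b} \<Longrightarrow> \<bar>r s - r t\<bar> \<le> \<omega>"
  shows "\<bar>(1-\<alpha>) * integral {a..b} (\<lambda>t. t powr (-\<alpha>) * r t)
           - (b powr (1-\<alpha>) - a powr (1-\<alpha>)) / (b - a) * integral {a..b} r\<bar>
         \<le> \<omega> * ((b powr (1-\<alpha>) - a powr (1-\<alpha>)) - (1-\<alpha>) * b powr (-\<alpha>) * (b - a))"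
proof -
  define J where "J = integral {a..b} r"
  define m where "m = J / (b - a)"
  have r_int: "(r has_integral J) {a..b}"
    unfolding J_def by (rule integrable_integral[OF integrable_continuous_real[OF r]])
  have w_int: "((\<lambda>t. t powr (-\<alpha>)) has_integral (b powr (1-\<alpha>) - a powr (1-\<alpha>)) / (1-\<alpha>)) {a..b}"
    using has_integral_powr_weight[of \<alpha> a b 1 0] \<alpha> ab by simp
  have wr_int: "((\<lambda>t. t powr (-\<alpha>) * r t) has_integral integral {a..b} (\<lambda>t. t powr (-\<alpha>) * r t)) {a..b}"
    using integrable_powr_weight[OF \<alpha> ab(1) _ r] ab by (intro integrable_integral) auto
  \<comment> \<open>\<open>r t - m\<close> is the average of \<open>r t - r s\<close> over
    \<open>s\<close>, so it is bounded by the oscillation.\<close>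
  have dev: "\<bar>r t - m\<bar> \<le> \<omega>" if t: "t \<in> {a..b}" for t
  proof -
    have "((\<lambda>s. r t - r s) has_integral (b - a) * r t - J) {a..b}"
      using has_integral_diff[OF has_integral_const_real[of "r t" a b] r_int] ab by simp
    hence "norm ((b - a) * r t - J) \<le> \<omega> * measure lborel {a..b}"
      using osc[OF t t] osc[OF t] by (intro has_integral_bound_real[of \<omega> "{}"]) auto
    moreover have "(b - a) * r t - J = (b - a) * (r t - m)"
      using ab by (simp add: m_def right_diff_distrib)
    ultimately have "(b - a) * \<bar>r t - m\<bar> \<le> (b - a) * \<omega>"
      using ab by (simp add: abs_mult mult.commute)
    thus ?thesis using ab by simp
  qed
  define g where "g t = \<omega> * (if t = 0 then (1-\<alpha>) * b powr (-\<alpha>) else (1-\<alpha>) * t powr (-\<alpha>) - (1-\<alpha>) * b powr (-\<alpha>))" for t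
  have f_int: "((\<lambda>t. ((1-\<alpha>) * t powr (-\<alpha>) - (1-\<alpha>) * b powr (-\<alpha>)) * (r t - m)) has_integral
      (1-\<alpha>) * integral {a..b} (\<lambda>t. t powr (-\<alpha>) * r t)
        - m * (b powr (1-\<alpha>) - a powr (1-\<alpha>)) - (1-\<alpha>) * b powr (-\<alpha>) * (J - (b - a) * m)) {a..b}"
  proof -
    have "((\<lambda>t. (1-\<alpha>) * (t powr (-\<alpha>) * r t) - (m * (1-\<alpha>)) * t powr (-\<alpha>) - (1-\<alpha>) * b powr (-\<alpha>) * (r t - m)) has_integral
      (1-\<alpha>) * integral {a..b} (\<lambda>t. t powr (-\<alpha>) * r t) - (m * (1-\<alpha>)) * ((b powr (1-\<alpha>) - a powr (1-\<alpha>)) / (1-\<alpha>))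
        - (1-\<alpha>) * b powr (-\<alpha>) * (J - (b - a) * m)) {a..b}"
      using has_integral_const_real[of m a b] ab
      by (intro has_integral_diff has_integral_mult_right wr_int w_int r_int) simp
    moreover have "(m * (1-\<alpha>)) * ((b powr (1-\<alpha>) - a powr (1-\<alpha>)) / (1-\<alpha>)) = m * (b powr (1-\<alpha>) - a powr (1-\<alpha>))"
      using \<alpha> by simp
    moreover have "(1-\<alpha>) * (t powr (-\<alpha>) * r t) - (m * (1-\<alpha>)) * t powr (-\<alpha>) - (1-\<alpha>) * b powr (-\<alpha>) * (r t - m)
        = ((1-\<alpha>) * t powr (-\<alpha>) - (1-\<alpha>) * b powr (-\<alpha>)) * (r t - m)" for t
      by (simp add: algebra_simps)
    ultimately show ?thesis by simp
  qed
  have g_int: "(g has_integral \<omega> * ((b powr (1-\<alpha>) - a powr (1-\<alpha>)) - (1-\<alpha>) * b powr (-\<alpha>) * (b - a))) {a..b}"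
  proof (rule has_integral_spike_finite[of "{0}"])
    show "g t = \<omega> * ((1-\<alpha>) * t powr (-\<alpha>) - (1-\<alpha>) * b powr (-\<alpha>))" if "t \<in> {a..b} - {0}" for t
      using that by (simp add: g_def)
    have "((\<lambda>t. \<omega> * ((1-\<alpha>) * t powr (-\<alpha>) - (1-\<alpha>) * b powr (-\<alpha>))) has_integral
       \<omega> * ((1-\<alpha>) * ((b powr (1-\<alpha>) - a powr (1-\<alpha>)) / (1-\<alpha>)) - (b - a) * ((1-\<alpha>) * b powr (-\<alpha>)))) {a..b}"
      using has_integral_const_real[of "(1-\<alpha>) * b powr (-\<alpha>)" a b] ab
      by (intro has_integral_diff has_integral_mult_right w_int) simp
    thus "((\<lambda>t. \<omega> * ((1-\<alpha>) * t powr (-\<alpha>) - (1-\<alpha>) * b powr (-\<alpha>))) has_integral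
       \<omega> * ((b powr (1-\<alpha>) - a powr (1-\<alpha>)) - (1-\<alpha>) * b powr (-\<alpha>) * (b - a))) {a..b}"
      using \<alpha> by (simp add: mult.commute)
  qed simp
  have fg: "norm (((1-\<alpha>) * t powr (-\<alpha>) - (1-\<alpha>) * b powr (-\<alpha>)) * (r t - m)) \<le> g t" if t: "t \<in> {a..b}" for t
  proof -
    \<comment> \<open>At the origin the weight evaluates to 0, so the excess is negative there;
      elsewhere \<open>t \<le> b\<close> makes it non-negative.\<close>
    have "\<bar>(1-\<alpha>) * t powr (-\<alpha>) - (1-\<alpha>) * b powr (-\<alpha>)\<bar> =
       (if t = 0 then (1-\<alpha>) * b powr (-\<alpha>) else (1-\<alpha>) * t powr (-\<alpha>) - (1-\<alpha>) * b powr (-\<alpha>))"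
    proof (cases "t = 0")
      case False
      hence "b powr (-\<alpha>) \<le> t powr (-\<alpha>)" using t ab \<alpha> by (intro powr_mono2') auto
      with False \<alpha> show ?thesis by (simp add: mult_left_mono)
    qed (use \<alpha> in simp)
    thus ?thesis unfolding g_def real_norm_def abs_mult
      using mult_left_mono[OF dev[OF t], of "\<bar>(1-\<alpha>) * t powr (-\<alpha>) - (1-\<alpha>) * b powr (-\<alpha>)\<bar>"]
      by (simp add: mult.commute)
  qed
  \<comment> \<open>The constant \<open>b powr (-\<alpha>)\<close> contributes nothing, because
    \<open>m\<close> is the mean of \<open>r\<close>.\<close>
  have "J - (b - a) * m = 0" using ab by (simp add: m_def)
  moreover have "m * (b powr (1-\<alpha>) - a powr (1-\<alpha>)) = (b powr (1-\<alpha>) - a powr (1-\<alpha>)) / (b - a) * J"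
    by (simp add: m_def)
  ultimately show ?thesis
    using integral_norm_bound_integral[OF has_integral_integrable[OF f_int] has_integral_integrable[OF g_int] fg]
    by (simp add: integral_unique[OF f_int] integral_unique[OF g_int] J_def)
qed

section \<open>Accumulated error on a uniform mesh\<close>

lemma integral_sum_nodes:
  fixes f :: "real \<Rightarrow> real"
  assumes "0 \<le> h" "f integrable_on {0..real n * h}"
  shows "integral {0..real n * h} f = (\<Sum>k<n. integral {real k * h..real (Suc k) * h} f)"
  using assms(2)
proof (induction n)
  case (Suc n)
  have le: "real n * h \<le> real (Suc n) * h" using assms(1) by (intro mult_right_mono) auto
  have "f integrable_on {0..real n * h}"
    by (rule integrable_subinterval_real[OF Suc.prems]) (use le in auto)
  moreover have "integral {0..real n * h} f + integral {real n * h..real (Suc n) * h} f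
      = integral {0..real (Suc n) * h} f"
    using le assms(1) Suc.prems by (intro Henstock_Kurzweil_Integration.integral_combine) auto
  ultimately show ?case using Suc.IH by simp
qed simp

text \<open>The coefficient of each cell integral is the mean of
  \<open>(1-\<alpha>) * t powr (-\<alpha>)\<close> over that cell. For
  \<open>p t = y' (x - t)\<close> the cell integrals are differences of nodal values, and the sum
  becomes the scaled \<sigma>-sum.\<close>

definition quad_defect :: "real \<Rightarrow> real \<Rightarrow> nat \<Rightarrow> (real \<Rightarrow> real) \<Rightarrow> real" where
  "quad_defect \<alpha> h n p = (1-\<alpha>) * integral {0..real n * h} (\<lambda>t. t powr (-\<alpha>) * p t)
     - (\<Sum>k<n. ((real (Suc k) * h) powr (1-\<alpha>) - (real k * h) powr (1-\<alpha>)) / h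
          * integral {real k * h..real (Suc k) * h} p)"

lemma quad_defect_add:
  assumes "0 < \<alpha>" "\<alpha> < 1" "0 \<le> h" "continuous_on {0..real n * h} p" "continuous_on {0..real n * h} q"
  shows "quad_defect \<alpha> h n (\<lambda>t. p t + q t) = quad_defect \<alpha> h n p + quad_defect \<alpha> h n q"
proof -
  have 1: "integral {0..real n * h} (\<lambda>t. t powr (-\<alpha>) * (p t + q t)) =
     integral {0..real n * h} (\<lambda>t. t powr (-\<alpha>) * p t) + integral {0..real n * h} (\<lambda>t. t powr (-\<alpha>) * q t)"
    unfolding distrib_left using assms by (intro integral_add integrable_powr_weight) auto
  have 2: "integral {real k * h..real (Suc k) * h} (\<lambda>t. p t + q t) =
     integral {real k * h..real (Suc k) * h} p + integral {real k * h..real (Suc k) * h} q" if "k < n" for k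
  proof -
    have "real (Suc k) * h \<le> real n * h" using that assms(3) by (intro mult_right_mono) auto
    hence "{real k * h..real (Suc k) * h} \<subseteq> {0..real n * h}" using assms(3) by auto
    thus ?thesis
      using assms(4,5) by (intro integral_add integrable_continuous_real) (blast intro: continuous_on_subset)+
  qed
  show ?thesis
    unfolding quad_defect_def 1 using 2 by (simp add: distrib_left sum.distrib del: of_nat_Suc)
qed

text \<open>The bracket is the upper Riemann sum of \<open>t powr \<beta>\<close> on [0,n]; the mean
  value theorem gives the comparison increment by increment.\<close>

lemma sum_powr_ge:
  fixes \<beta> :: real
  assumes "0 < \<beta>"
  shows "real n powr (1+\<beta>) \<le> (1+\<beta>) * ((\<Sum>k<n. real k powr \<beta>) + real n powr \<beta>)"
proof (induction n)
  case (Suc n)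
  have "real (Suc n) powr (1+\<beta>) - real n powr (1+\<beta>) \<le> (1+\<beta>) * real (Suc n) powr \<beta>"
  proof (cases "n = 0")
    case False
    then obtain z where z: "real n < z" "z < real (Suc n)"
      "real (Suc n) powr (1+\<beta>) - real n powr (1+\<beta>) = (real (Suc n) - real n) * ((1+\<beta>) * z powr (1 + \<beta> - 1))"
      using powr_mvt[of "real n" "real (Suc n)" "1 + \<beta>"] by auto
    have "z powr \<beta> \<le> real (Suc n) powr \<beta>" using z(1,2) assms by (intro powr_mono2) auto
    thus ?thesis unfolding z(3) using assms by (simp add: mult_left_mono)
  qed (use assms in simp)
  with Suc show ?case by (simp add: distrib_left)
qed simp

lemma sum_by_parts_powr:
  fixes \<beta> :: real
  shows "(\<Sum>k<n. real (Suc k) * (real (Suc k) powr \<beta> - real k powr \<beta>)) = real n * real n powr \<beta> - (\<Sum>k<n. real k powr \<beta>)"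
  by (induction n) (auto simp: algebra_simps)

text \<open>The oscillation may grow linearly with the cell index. The cell errors are summed by
  parts, and the term subtracted in \<open>weighted_mean_error\<close> is essential: it removes the
  leading order \<open>n powr (1 + \<beta>)\<close>, so that \<open>sum_powr_ge\<close> leaves only
  \<open>n powr \<beta>\<close>.\<close>

lemma quad_defect_bound:
  assumes \<alpha>: "0 < \<alpha>" "\<alpha> < 1" and "0 < h" "0 \<le> M" and r: "continuous_on {0..real n * h} r"
    and osc: "\<And>k s t. k < n \<Longrightarrow> s \<in> {real k * h..real (Suc k) * h} \<Longrightarrow> t \<in> {real k * h..real (Suc k) * h}
       \<Longrightarrow> \<bar>r s - r t\<bar> \<le> M * real (Suc k)"
  shows "\<bar>quad_defect \<alpha> h n r\<bar> \<le> M * (real n * h) powr (1-\<alpha>)"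
proof -
  define \<beta> where "\<beta> = 1 - \<alpha>"
  have \<beta>: "0 < \<beta>" "- \<alpha> = \<beta> - 1" "1 - \<alpha> = \<beta>" using \<alpha> by (auto simp: \<beta>_def)
  define e where "e k = (1-\<alpha>) * integral {real k * h..real (Suc k) * h} (\<lambda>t. t powr (-\<alpha>) * r t)
     - ((real (Suc k) * h) powr (1-\<alpha>) - (real k * h) powr (1-\<alpha>)) / h
          * integral {real k * h..real (Suc k) * h} r" for k
  have "(\<lambda>t. t powr (-\<alpha>) * r t) integrable_on {0..real n * h}"
    using \<open>0 < h\<close> by (intro integrable_powr_weight \<alpha> r) auto
  from integral_sum_nodes[OF _ this]
  have "quad_defect \<alpha> h n r = (\<Sum>k<n. e k)"
    using \<open>0 < h\<close> by (simp add: quad_defect_def e_def sum_distrib_left sum_subtractf del: of_nat_Suc)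
  hence "\<bar>quad_defect \<alpha> h n r\<bar> \<le> (\<Sum>k<n. \<bar>e k\<bar>)" by simp
  also have "\<dots> \<le> (\<Sum>k<n. M * h powr \<beta> * (real (Suc k) * (real (Suc k) powr \<beta> - real k powr \<beta>) - \<beta> * real (Suc k) powr \<beta>))"
  proof (rule sum_mono)
    fix k assume "k \<in> {..<n}"
    hence k: "k < n" by simp
    have len: "real (Suc k) * h - real k * h = h" by (simp add: algebra_simps)
    have "real (Suc k) * h \<le> real n * h" using k \<open>0 < h\<close> by (intro mult_right_mono) auto
    hence "{real k * h..real (Suc k) * h} \<subseteq> {0..real n * h}" using \<open>0 < h\<close> by auto
    hence "continuous_on {real k * h..real (Suc k) * h} r" using r continuous_on_subset by blast
    from weighted_mean_error[OF \<alpha> _ _ this osc[OF k], unfolded len]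
    have "\<bar>e k\<bar> \<le> M * real (Suc k) * ((real (Suc k) * h) powr (1-\<alpha>) - (real k * h) powr (1-\<alpha>)
        - (1-\<alpha>) * (real (Suc k) * h) powr (-\<alpha>) * h)"
      unfolding e_def using \<open>0 < h\<close> by simp
    also have "\<dots> = M * h powr \<beta> * (real (Suc k) * (real (Suc k) powr \<beta> - real k powr \<beta>) - \<beta> * (real (Suc k) * real (Suc k) powr (-\<alpha>)))"
    proof -
      have "(real (Suc k) * h) powr (-\<alpha>) * h = real (Suc k) powr (-\<alpha>) * h powr \<beta>"
        using \<open>0 < h\<close> by (simp add: powr_mult \<beta> powr_diff del: of_nat_Suc)
      hence 1: "(1-\<alpha>) * (real (Suc k) * h) powr (-\<alpha>) * h = \<beta> * (real (Suc k) powr (-\<alpha>) * h powr \<beta>)"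
        by (simp add: \<beta>_def)
      show ?thesis unfolding 1 unfolding \<beta>(3) powr_mult by (simp add: algebra_simps del: of_nat_Suc)
    qed
    also have "real (Suc k) * real (Suc k) powr (-\<alpha>) = real (Suc k) powr \<beta>"
      by (simp add: \<beta> powr_diff del: of_nat_Suc)
    finally show "\<bar>e k\<bar> \<le> M * h powr \<beta> * (real (Suc k) * (real (Suc k) powr \<beta> - real k powr \<beta>) - \<beta> * real (Suc k) powr \<beta>)" .
  qed
  also have "\<dots> = M * h powr \<beta> * (real n * real n powr \<beta> - (\<Sum>k<n. real k powr \<beta>) - \<beta> * (\<Sum>k<n. real (Suc k) powr \<beta>))"
    by (simp add: sum_distrib_left[symmetric] sum_subtractf sum_by_parts_powr del: of_nat_Suc)
  also have "(\<Sum>k<n. real (Suc k) powr \<beta>) = (\<Sum>k<n. real k powr \<beta>) + real n powr \<beta>"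
    using sum.lessThan_Suc_shift[of "\<lambda>k. real k powr \<beta>" n] by simp
  also have "M * h powr \<beta> * (real n * real n powr \<beta> - (\<Sum>k<n. real k powr \<beta>) - \<beta> * ((\<Sum>k<n. real k powr \<beta>) + real n powr \<beta>))
      \<le> M * h powr \<beta> * real n powr \<beta>"
  proof (rule mult_left_mono)
    have "real n * real n powr \<beta> = real n powr (1 + \<beta>)" by (simp add: powr_mult_base)
    with sum_powr_ge[OF \<beta>(1), of n]
    show "real n * real n powr \<beta> - (\<Sum>k<n. real k powr \<beta>) - \<beta> * ((\<Sum>k<n. real k powr \<beta>) + real n powr \<beta>) \<le> real n powr \<beta>"
      by (simp add: algebra_simps)
  qed (use \<open>0 \<le> M\<close> in simp)
  finally show ?thesis by (simp add: powr_mult \<beta>_def mult_ac)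
qed

lemma sum_weights_midpoints:
  fixes \<beta> :: real
  shows "(\<Sum>k<n. (real (Suc k) powr \<beta> - real k powr \<beta>) * (2 * real k + 1))
           = (2 * real n - 1) * real n powr \<beta> - 2 * (\<Sum>k<n. real k powr \<beta>)"
  by (induction n) (auto simp: algebra_simps)

text \<open>Constants are integrated exactly because the cell means carry the total weight. A linear
  function contributes its midpoint values; summation by parts turns these into the trapezoidal
  error for \<open>t powr (1-\<alpha>)\<close> on [0,n], whose endpoint term at 0 vanishes.\<close>

lemma quad_defect_linear:
  assumes \<alpha>: "0 < \<alpha>" "\<alpha> < 1" and "0 < h"
  shows "quad_defect \<alpha> h n (\<lambda>t. c0 + c1 * t) = c1 * h powr (2-\<alpha>) *
     ((\<Sum>k<n. real k powr (1-\<alpha>)) - (real n powr (2-\<alpha>) / (2-\<alpha>) - real n powr (1-\<alpha>) / 2))"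
proof -
  define \<beta> where "\<beta> = 1 - \<alpha>"
  have \<beta>: "0 < \<beta>" "2 - \<alpha> = 1 + \<beta>" "1 - \<alpha> = \<beta>" using \<alpha> by (auto simp: \<beta>_def)
  have nn: "real n * real n powr \<beta> = real n powr (1 + \<beta>)" by (simp add: powr_mult_base)
  have hh: "h * h powr \<beta> = h powr (1 + \<beta>)" using \<open>0 < h\<close> by (simp add: powr_mult_base)
  have lin: "integral {real k * h..real (Suc k) * h} (\<lambda>t. c0 + c1 * t) = h * c0 + h * (c1 * h / 2 * (2 * real k + 1))" for k
  proof (rule integral_unique)
    define F where "F t = c0 * t + c1 * t\<^sup>2 / 2" for t
    have "((\<lambda>t. c0 + c1 * t) has_integral (F (real (Suc k) * h) - F (real k * h))) {real k * h..real (Suc k) * h}"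
      unfolding F_def using \<open>0 < h\<close>
      by (intro fundamental_theorem_of_calculus)
         (auto intro!: derivative_eq_intros simp flip: has_real_derivative_iff_has_vector_derivative)
    also have "F (real (Suc k) * h) - F (real k * h) = h * c0 + h * (c1 * h / 2 * (2 * real k + 1))"
      by (simp add: F_def power2_eq_square field_simps)
    finally show "((\<lambda>t. c0 + c1 * t) has_integral h * c0 + h * (c1 * h / 2 * (2 * real k + 1))) {real k * h..real (Suc k) * h}" .
  qed
  have summand: "((real (Suc k) * h) powr \<beta> - (real k * h) powr \<beta>) / h
          * integral {real k * h..real (Suc k) * h} (\<lambda>t. c0 + c1 * t)
      = h powr \<beta> * (c0 * (real (Suc k) powr \<beta> - real k powr \<beta>)
         + c1 * h / 2 * ((real (Suc k) powr \<beta> - real k powr \<beta>) * (2 * real k + 1)))" for k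
    unfolding lin powr_mult using \<open>0 < h\<close> by (simp add: field_simps)
  have "(\<Sum>k<n. ((real (Suc k) * h) powr \<beta> - (real k * h) powr \<beta>) / h
          * integral {real k * h..real (Suc k) * h} (\<lambda>t. c0 + c1 * t))
     = h powr \<beta> * (c0 * real n powr \<beta> + c1 * h / 2 * ((2 * real n - 1) * real n powr \<beta> - 2 * (\<Sum>k<n. real k powr \<beta>)))"
    unfolding summand sum_weights_midpoints[symmetric] sum_distrib_left[symmetric] sum.distrib
    using sum_lessThan_telescope[of "\<lambda>k. real k powr \<beta>" n] by (simp add: sum_distrib_left[symmetric] del: of_nat_Suc)
  moreover have "integral {0..real n * h} (\<lambda>t. t powr (-\<alpha>) * (c0 + c1 * t)) =
      c0 * (real n * h) powr \<beta> / \<beta> + c1 * (real n * h) powr (1+\<beta>) / (1+\<beta>)"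
    using has_integral_powr_weight[of \<alpha> 0 "real n * h" c0 c1] \<alpha> \<open>0 < h\<close>
    by (intro integral_unique) (simp add: \<beta>)
  ultimately have "quad_defect \<alpha> h n (\<lambda>t. c0 + c1 * t) =
      \<beta> * (c0 * (real n powr \<beta> * h powr \<beta>) / \<beta> + c1 * (real n powr (1 + \<beta>) * h powr (1 + \<beta>)) / (1+\<beta>))
      - (c0 * real n powr \<beta> * h powr \<beta> + c1 * (h * h powr \<beta>) / 2 * (2 * (real n * real n powr \<beta>) - real n powr \<beta> - 2 * (\<Sum>k<n. real k powr \<beta>)))"
    unfolding quad_defect_def \<beta>(3) powr_mult by (simp add: algebra_simps)
  also have "\<dots> = c1 * h powr (1+\<beta>) * ((\<Sum>k<n. real k powr \<beta>) - (real n powr (1+\<beta>) / (1+\<beta>) - real n powr \<beta> / 2))"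
    unfolding nn hh using \<beta>(1) by (simp add: divide_simps) (simp add: algebra_simps)
  finally show ?thesis by (simp only: \<beta>)
qed

section \<open>The corrected L1 formula\<close>

lemma integral_reflect_shift:
  fixes g :: "real \<Rightarrow> real"
  shows "integral {0..x} (\<lambda>t. g (x - t)) = integral {0..x} g"
proof -
  have "integral {0..x} (\<lambda>t. g (x - t)) = integral {-x..-0} (\<lambda>t. g (x + t))"
    using Henstock_Kurzweil_Integration.integral_reflect_real[of x 0 "\<lambda>t. g (x - t)"] by simp
  also have "\<dots> = integral {0..x} g"
    using integral_shift_real_ivl[of 0 x x g] by (simp add: add.commute)
  finally show ?thesis .
qed

text \<open>The coefficients are the backward differences of \<open>b k\<close>, with
  \<open>b\<close> read as 0 outside \<open>{0..<n}\<close>. This explains the exceptional values at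
  \<open>k = 0\<close> and \<open>k = n\<close>.\<close>

lemma sum_sigma_coef:
  assumes "1 \<le> n"
  shows "(\<Sum>k=0..n. sigma_coef \<alpha> n k * u k)
           = (\<Sum>k<n. (real (Suc k) powr (1-\<alpha>) - real k powr (1-\<alpha>)) * (u k - u (Suc k)))"
proof -
  define b where "b k = real (Suc k) powr (1-\<alpha>) - real k powr (1-\<alpha>)" for k
  have "sigma_coef \<alpha> n k = (if k < n then b k else 0) - (if k = 0 then 0 else b (k - 1))" if "k \<le> n" for k
    using that assms by (cases k) (auto simp: sigma_coef_def b_def add.commute)
  hence "(\<Sum>k=0..n. sigma_coef \<alpha> n k * u k)
      = (\<Sum>k\<le>n. (if k < n then b k else 0) * u k) - (\<Sum>k\<le>n. (if k = 0 then 0 else b (k - 1)) * u k)"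
    by (simp add: atMost_atLeast0 left_diff_distrib flip: sum_subtractf)
  also have "(\<Sum>k\<le>n. (if k < n then b k else 0) * u k) = (\<Sum>k<n. b k * u k)"
    by (simp flip: lessThan_Suc_atMost)
  also have "(\<Sum>k\<le>n. (if k = 0 then 0 else b (k - 1)) * u k) = (\<Sum>k<n. b k * u (Suc k))"
    unfolding lessThan_Suc_atMost[symmetric] sum.lessThan_Suc_shift by simp
  finally show ?thesis by (simp add: b_def right_diff_distrib sum_subtractf)
qed

text \<open>The zeta corrections assemble into a second difference at the first three nodes, all of
  which belong to the sum when \<open>n \<ge> 2\<close>.\<close>

lemma sum_delta_coef:
  assumes "2 \<le> n"
  shows "(\<Sum>k=0..n. delta_coef \<alpha> n k * u k)
           = (\<Sum>k=0..n. sigma_coef \<alpha> n k * u k) - zeta_real (\<alpha> - 1) * (u 0 - 2 * u 1 + u 2)"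
proof -
  define z where "z = zeta_real (\<alpha> - 1)"
  have "delta_coef \<alpha> n k * u k = sigma_coef \<alpha> n k * u k
      + ((if k = 0 then - z * u 0 else 0) + (if k = 1 then 2 * z * u 1 else 0) + (if k = 2 then - z * u 2 else 0))" for k
    by (simp add: delta_coef_def z_def algebra_simps)
  thus ?thesis
    using assms by (simp add: sum.distrib algebra_simps flip: z_def)
qed

text \<open>The reflection maps the interval onto itself, so the chain rule also covers the
  one-sided derivatives at the endpoints.\<close>

lemma DERIV_reflect:
  fixes f :: "real \<Rightarrow> real"
  assumes "(f has_real_derivative f') (at (x - t) within {0..x})" "t \<in> {0..x}"
  shows "((\<lambda>t. f (x - t)) has_real_derivative - f') (at t within {0..x})"
proof -
  have "(\<lambda>t. x - t) ` {0..x} = {0..x}" by (auto simp: image_iff intro!: bexI[of _ "x - _"])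
  moreover have "((\<lambda>t. x - t) has_real_derivative -1) (at t within {0..x})"
    by (auto intro!: derivative_eq_intros)
  ultimately show ?thesis
    using DERIV_image_chain[of f f' "\<lambda>t. x - t" t "{0..x}" "-1"] assms(1) by (simp add: o_def)
qed

theorem theorem8:
  fixes \<alpha> x :: real
  assumes "0 < \<alpha>" and "\<alpha> < 1" and "0 < x"
  shows "\<exists>r. \<forall>y. Ck_on r {0..x} y \<longrightarrow>
           (\<lambda>n::nat. caputo \<alpha> y x
              - (1 / (Gamma (2 - \<alpha>) * (x / real n) powr \<alpha>)) *
                (\<Sum>k = 0..n. delta_coef \<alpha> n k * y (x - real k * (x / real n))))
           \<in> O(\<lambda>n. (x / real n) ^ 2)"
proof (intro exI[of _ 3] allI impI)
  fix y assume "Ck_on 3 {0..x} y"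
  then obtain D where D0: "D 0 = y"
    and deriv: "\<And>k t. k < 3 \<Longrightarrow> t \<in> {0..x} \<Longrightarrow> (D k has_real_derivative D (Suc k) t) (at t within {0..x})"
    and cont: "\<And>k. k \<le> 3 \<Longrightarrow> continuous_on {0..x} (D k)"
    unfolding Ck_on_def by blast
  have deriv': "((\<lambda>t. D k (x - t)) has_real_derivative - D (Suc k) (x - t)) (at t within {0..x})"
    if "k < 3" "t \<in> {0..x}" for k t
    using that by (intro DERIV_reflect deriv) auto
  \<comment> \<open>A bounded third derivative makes \<open>D 2\<close> Lipschitz; this is what
    fixes the smoothness order 3.\<close>
  have "bounded (D 3 ` {0..x})"
    by (intro compact_imp_bounded compact_continuous_image cont) auto
  then obtain M where M: "0 < M" "\<And>u. u \<in> {0..x} \<Longrightarrow> \<bar>D 3 u\<bar> \<le> M"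
    unfolding bounded_pos by force
  define p where "p t = D 1 (x - t)" for t
  \<comment> \<open>\<open>r\<close> is the first-order Taylor remainder of \<open>p\<close> at 0
    and \<open>v\<close> the second-order one of \<open>y (x - t)\<close>. Hence
    \<open>v' = - r\<close>, and \<open>r'\<close> is O(t).\<close>
  define r where "r t = D 1 (x - t) - D 1 x + D 2 x * t" for t
  define v where "v t = y (x - t) - y x + D 1 x * t - D 2 x * t\<^sup>2 / 2" for t
  have p_cont: "continuous_on {0..x} p"
    unfolding p_def by (rule continuous_on_compose2[OF cont[of 1]]) (auto intro!: continuous_intros)
  hence r_cont: "continuous_on {0..x} r"
    unfolding r_def p_def by (intro continuous_intros) auto
  have D2: "\<bar>D 2 (x - t) - D 2 x\<bar> \<le> M * t" if t: "t \<in> {0..x}" for t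
  proof -
    have "norm (D 2 (x - t) - D 2 x) \<le> M * norm (x - t - x)"
      using t \<open>0 < x\<close> deriv[of 2] M(2)
      by (intro field_differentiable_bound[of "{0..x}" "D 2" "D 3"]) (auto simp: numeral_3_eq_3 numeral_2_eq_2)
    thus ?thesis using t by simp
  qed
  \<comment> \<open>The factor \<open>c\<close> reflects \<open>r' = O(t)\<close>. With
    \<open>c = (k + 1) * h\<close> it produces the linear growth allowed in
    \<open>quad_defect_bound\<close>.\<close>
  have r_osc: "\<bar>r s - r t\<bar> \<le> M * c * \<bar>s - t\<bar>" if c: "c \<le> x" "s \<in> {0..c}" "t \<in> {0..c}" for c s t
    unfolding real_norm_def[symmetric]
  proof (rule field_differentiable_bound[of "{0..c}" r "\<lambda>t. - D 2 (x - t) + D 2 x"])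
    fix z assume z: "z \<in> {0..c}"
    have "(r has_real_derivative - D 2 (x - z) - 0 + D 2 x * 1) (at z within {0..x})"
      unfolding r_def using deriv'[of 1 z] z c
      by (intro DERIV_add DERIV_diff DERIV_cmult DERIV_const DERIV_ident) (auto simp: numeral_2_eq_2)
    thus "(r has_real_derivative - D 2 (x - z) + D 2 x) (at z within {0..c})"
      using c by (auto intro: DERIV_subset)
    have "M * z \<le> M * c" using z M(1) by simp
    thus "norm (- D 2 (x - z) + D 2 x) \<le> M * c"
      using D2[of z] z c by (simp add: abs_minus_commute)
  qed (use c in auto)
  have v_bound: "\<bar>v t\<bar> \<le> M * c ^ 3" if c: "c \<le> x" "t \<in> {0..c}" for c t
  proof -
    have "norm (v t - v 0) \<le> (M * c * c) * norm (t - 0)"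
    proof (rule field_differentiable_bound[of "{0..c}" v "\<lambda>t. - r t"])
      fix z assume z: "z \<in> {0..c}"
      have "((\<lambda>t. y (x - t)) has_real_derivative - D 1 (x - z)) (at z within {0..x})"
        using deriv'[of 0 z] z c by (simp add: D0)
      hence "(v has_real_derivative - r z) (at z within {0..x})"
        unfolding v_def r_def by (auto intro!: derivative_eq_intros)
      thus "(v has_real_derivative - r z) (at z within {0..c})"
        using c by (auto intro: DERIV_subset)
      have "\<bar>r z\<bar> \<le> M * c * \<bar>z\<bar>" using r_osc[of c z 0] z c by (simp add: r_def)
      also have "\<dots> \<le> M * c * c" using z M(1) by (intro mult_left_mono) auto
      finally show "norm (- r z) \<le> M * c * c" by simp
    qed (use c in auto)
    also have "\<dots> \<le> (M * c * c) * c" using c M(1) by (intro mult_left_mono) auto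
    finally show ?thesis by (simp add: v_def power3_eq_cube mult_ac)
  qed
  define \<beta> where "\<beta> = 1 - \<alpha>"
  have \<beta>: "0 < \<beta>" "\<beta> < 1" "1 - \<alpha> = \<beta>" "2 - \<alpha> = 1 + \<beta>" "\<alpha> - 1 = - \<beta>" "-\<alpha> = \<beta> - 1"
    using assms by (auto simp: \<beta>_def)
  obtain C where C: "\<And>n. n \<ge> 1 \<Longrightarrow> \<bar>(\<Sum>k<n. real k powr \<beta>)
      - (real n powr (1 + \<beta>) / (1 + \<beta>) - real n powr \<beta> / 2 + zeta_real (- \<beta>))\<bar> \<le> C * real n powr (\<beta> - 1)"
    using sum_powr_zeta[OF \<beta>(1,2)] by blast
  define z where "z = zeta_real (- \<beta>)"
  define I where "I = integral {0..x} (\<lambda>t. t powr (-\<alpha>) * p t)"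
  define G where "G = Gamma (2 - \<alpha>)"
  have "\<beta> \<notin> \<int>\<^sub>\<le>\<^sub>0" using \<beta>(1) by (auto elim!: nonpos_Ints_cases)
  hence G: "G = \<beta> * Gamma \<beta>" "G > 0"
    \<comment> \<open>The functional equation of Gamma turns the factor
      \<open>1 / Gamma (1 - \<alpha>)\<close> of the Caputo derivative into
      \<open>\<beta> / G\<close>.\<close>
    using Gamma_plus1[of \<beta>] \<beta>(1) by (simp_all add: G_def \<beta>(4) add.commute Gamma_real_pos)
  have caputo: "caputo \<alpha> y x = (1 / G) * (\<beta> * I)"
  proof -
    have "integral {0..x} (\<lambda>\<xi>. vector_derivative y (at \<xi> within {0..x}) / (x - \<xi>) powr \<alpha>)
        = integral {0..x} (\<lambda>\<xi>. (x - \<xi>) powr (-\<alpha>) * p (x - \<xi>))"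
    proof (rule integral_cong)
      fix \<xi> assume \<xi>: "\<xi> \<in> {0..x}"
      have "(y has_vector_derivative D 1 \<xi>) (at \<xi> within {0..x})"
        using deriv[of 0 \<xi>] \<xi> by (simp add: D0 has_real_derivative_iff_has_vector_derivative)
      hence "vector_derivative y (at \<xi> within {0..x}) = D 1 \<xi>"
        using \<open>0 < x\<close> \<xi> by (intro vector_derivative_within_closed_interval)
      thus "vector_derivative y (at \<xi> within {0..x}) / (x - \<xi>) powr \<alpha> = (x - \<xi>) powr (-\<alpha>) * p (x - \<xi>)"
        by (simp add: p_def powr_minus divide_inverse mult.commute)
    qed
    also have "\<dots> = I"
      unfolding I_def by (rule integral_reflect_shift)
    finally show ?thesis using \<beta>(1) G(1) by (simp add: caputo_def \<beta>(3))
  qed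
  \<comment> \<open>The three summands bound, in order, the trapezoidal error beyond its zeta
    constant, the defect of \<open>r\<close>, and the remainder \<open>R\<close> of the second
    difference.\<close>
  define K where "K = (\<bar>D 2 x\<bar> * C * x powr (-\<alpha>) + M * x powr \<beta> + 24 * \<bar>z\<bar> * M * x powr \<beta>) / G"
  have "norm (caputo \<alpha> y x - (1 / (Gamma (2 - \<alpha>) * (x / real n) powr \<alpha>)) *
          (\<Sum>k = 0..n. delta_coef \<alpha> n k * y (x - real k * (x / real n))))
        \<le> K * norm ((x / real n) ^ 2)" if n: "n \<ge> 2" for n :: nat
  proof -
    define h where "h = x / real n"
    have h: "h > 0" "real n * h = x" "2 * h \<le> x" "h \<le> x"
      using n \<open>0 < x\<close> by (auto simp: h_def field_simps)
    have hp: "h powr (1+\<beta>) = h powr (-\<alpha>) * h\<^sup>2" "h powr \<beta> = h powr (-\<alpha>) * h"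
      using h(1) by (simp_all add: \<beta>(6) powr_add powr_diff power2_eq_square)
    define u where "u k = y (x - real k * h)" for k
    define S where "S = (\<Sum>k=0..n. sigma_coef \<alpha> n k * u k)"
    define R where "R = v 0 - 2 * v h + v (2 * h)"
    define e where "e = (\<Sum>k<n. real k powr \<beta>) - (real n powr (1 + \<beta>) / (1 + \<beta>) - real n powr \<beta> / 2 + z)"
    \<comment> \<open>An antiderivative of \<open>p\<close> is \<open>- y (x - t)\<close>, so each
      cell integral is a difference of nodal values.\<close>
    have u_int: "integral {real k * h..real (Suc k) * h} p = u k - u (Suc k)" if "k < n" for k
    proof -
      have "real (Suc k) * h \<le> real n * h" using that h(1) by (intro mult_right_mono) auto
      hence sub: "{real k * h..real (Suc k) * h} \<subseteq> {0..x}" using h by auto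
      have "(p has_integral (- y (x - real (Suc k) * h)) - (- y (x - real k * h))) {real k * h..real (Suc k) * h}"
      proof (rule fundamental_theorem_of_calculus)
        fix t assume "t \<in> {real k * h..real (Suc k) * h}"
        with sub have "t \<in> {0..x}" by blast
        hence "((\<lambda>t. - y (x - t)) has_real_derivative p t) (at t within {0..x})"
          using DERIV_minus[OF deriv'[of 0 t]] by (simp add: D0 p_def)
        thus "((\<lambda>t. - y (x - t)) has_vector_derivative p t) (at t within {real k * h..real (Suc k) * h})"
          using sub by (auto intro: DERIV_subset simp flip: has_real_derivative_iff_has_vector_derivative)
      qed (use h in \<open>simp add: mult_right_mono\<close>)
      thus ?thesis by (simp add: u_def integral_unique)
    qed
    have "quad_defect \<alpha> h n p = \<beta> * I - h powr (-\<alpha>) * S"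
    proof -
      have "((real (Suc k) * h) powr \<beta> - (real k * h) powr \<beta>) / h * integral {real k * h..real (Suc k) * h} p
          = h powr (-\<alpha>) * ((real (Suc k) powr \<beta> - real k powr \<beta>) * (u k - u (Suc k)))" if "k < n" for k
        using h(1) unfolding u_int[OF that] powr_mult hp(2) by (simp add: field_simps del: of_nat_Suc)
      moreover have "S = (\<Sum>k<n. (real (Suc k) powr \<beta> - real k powr \<beta>) * (u k - u (Suc k)))"
        unfolding S_def using sum_sigma_coef[of n \<alpha> u] n by (simp only: \<beta>(3))
      ultimately show ?thesis
        unfolding quad_defect_def h(2) \<beta>(3) I_def by (simp add: sum_distrib_left)
    qed
    moreover have "quad_defect \<alpha> h n p = - D 2 x * h powr (1+\<beta>) * (z + e) + quad_defect \<alpha> h n r"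
    proof -
      have "p = (\<lambda>t. (D 1 x + (- D 2 x) * t) + r t)" by (simp add: p_def r_def fun_eq_iff)
      hence "quad_defect \<alpha> h n p = quad_defect \<alpha> h n (\<lambda>t. D 1 x + (- D 2 x) * t) + quad_defect \<alpha> h n r"
        using assms h r_cont by (simp only:) (intro quad_defect_add continuous_intros, auto)
      thus ?thesis
        unfolding quad_defect_linear[OF assms(1,2) h(1)] by (simp add: e_def \<beta>)
    qed
    \<comment> \<open>The second difference annihilates the constant and linear Taylor terms and
      maps \<open>t\<^sup>2 / 2\<close> to \<open>h\<^sup>2\<close>.\<close>
    moreover have "u 0 - 2 * u 1 + u 2 = D 2 x * h\<^sup>2 + R"
      by (simp add: u_def R_def v_def power2_eq_square)
    \<comment> \<open>The two zeta terms cancel: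
      \<open>h powr (-\<alpha>) * z * D 2 x * h\<^sup>2\<close> from the correction against
      \<open>D 2 x * h powr (1+\<beta>) * z\<close> from the linear part.\<close>
    ultimately have main: "\<beta> * I - h powr (-\<alpha>) * (S - z * (u 0 - 2 * u 1 + u 2))
        = - D 2 x * h powr (1+\<beta>) * e + quad_defect \<alpha> h n r + h powr (-\<alpha>) * z * R"
      unfolding hp by (simp add: algebra_simps)
    have "\<bar>- D 2 x * h powr (1+\<beta>) * e\<bar> \<le> \<bar>D 2 x\<bar> * h powr (1+\<beta>) * (C * real n powr (-\<alpha>))"
      using C[of n] n by (simp add: abs_mult e_def z_def \<beta>(6) mult_left_mono)
    \<comment> \<open>The decay \<open>n powr (-\<alpha>)\<close> combines with
      \<open>h powr (-\<alpha>)\<close> into the constant \<open>x powr (-\<alpha>)\<close>, which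
      leaves exactly \<open>h\<^sup>2\<close>.\<close>
    also have "\<dots> = \<bar>D 2 x\<bar> * C * (real n * h) powr (-\<alpha>) * h\<^sup>2"
      unfolding hp powr_mult by (simp add: mult_ac)
    finally have 1: "\<bar>- D 2 x * h powr (1+\<beta>) * e\<bar> \<le> \<bar>D 2 x\<bar> * C * x powr (-\<alpha>) * h\<^sup>2"
      by (simp only: h(2))
    have "\<bar>quad_defect \<alpha> h n r\<bar> \<le> (M * h\<^sup>2) * (real n * h) powr (1-\<alpha>)"
    proof (rule quad_defect_bound[OF assms(1,2) h(1)])
      fix k s t assume k: "k < n" and st: "s \<in> {real k * h..real (Suc k) * h}" "t \<in> {real k * h..real (Suc k) * h}"
      have c: "real (Suc k) * h \<le> x"
        unfolding h(2)[symmetric] using k h(1) by (intro mult_right_mono) auto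
      have "0 \<le> real k * h" using h(1) by simp
      with st have "\<bar>r s - r t\<bar> \<le> M * (real (Suc k) * h) * \<bar>s - t\<bar>"
        by (intro r_osc c) auto
      also have "\<dots> \<le> M * (real (Suc k) * h) * h"
        using st M(1) h(1) by (intro mult_left_mono) (auto simp: algebra_simps abs_le_iff)
      finally show "\<bar>r s - r t\<bar> \<le> M * h\<^sup>2 * real (Suc k)"
        by (simp only: power2_eq_square mult_ac)
    qed (use M(1) r_cont h in auto)
    hence 2: "\<bar>quad_defect \<alpha> h n r\<bar> \<le> M * x powr \<beta> * h\<^sup>2"
      unfolding h(2) \<beta>(3) by (simp only: mult_ac)
    have "\<bar>R\<bar> \<le> \<bar>v 0\<bar> + 2 * \<bar>v h\<bar> + \<bar>v (2 * h)\<bar>"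
      unfolding R_def by linarith
    \<comment> \<open>Both \<open>v h\<close> and \<open>v (2 * h)\<close> are estimated with
      \<open>c = 2 * h\<close>, so the constant 24 below is 3 times 8.\<close>
    also have "\<dots> \<le> 0 + 2 * (M * (2 * h) ^ 3) + M * (2 * h) ^ 3"
      using h by (intro add_mono mult_left_mono v_bound) (auto simp: v_def)
    finally have "\<bar>h powr (-\<alpha>) * z * R\<bar> \<le> h powr (-\<alpha>) * \<bar>z\<bar> * (24 * M * h ^ 3)"
      by (simp add: abs_mult mult_left_mono power_mult_distrib)
    also have "\<dots> = 24 * \<bar>z\<bar> * M * h powr \<beta> * h\<^sup>2"
      unfolding hp by (simp add: power2_eq_square power3_eq_cube)
    \<comment> \<open>This contribution is of order \<open>h powr (2 + \<beta>)\<close>;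
      \<open>h \<le> x\<close> suffices to absorb the surplus power.\<close>
    also have "\<dots> \<le> 24 * \<bar>z\<bar> * M * x powr \<beta> * h\<^sup>2"
      using h M(1) \<beta> by (intro mult_right_mono mult_left_mono powr_mono2) auto
    finally have 3: "\<bar>h powr (-\<alpha>) * z * R\<bar> \<le> 24 * \<bar>z\<bar> * M * x powr \<beta> * h\<^sup>2" .
    have "caputo \<alpha> y x - (1 / (G * h powr \<alpha>)) * (\<Sum>k = 0..n. delta_coef \<alpha> n k * u k)
        = (\<beta> * I - h powr (-\<alpha>) * (S - z * (u 0 - 2 * u 1 + u 2))) / G"
      unfolding sum_delta_coef[OF n] caputo S_def[symmetric] \<beta>(5) z_def[symmetric]
      by (simp add: powr_minus divide_inverse algebra_simps)
    also have "\<bar>\<dots>\<bar> \<le> K * h\<^sup>2"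
    proof -
      have KG: "K * G = \<bar>D 2 x\<bar> * C * x powr (-\<alpha>) + M * x powr \<beta> + 24 * \<bar>z\<bar> * M * x powr \<beta>"
        using G(2) by (simp add: K_def)
      have "\<bar>\<beta> * I - h powr (-\<alpha>) * (S - z * (u 0 - 2 * u 1 + u 2))\<bar> \<le> (K * G) * h\<^sup>2"
        using 1 2 3 unfolding main KG distrib_right by linarith
      thus ?thesis using G(2) by (simp add: divide_simps mult_ac)
    qed
    finally show ?thesis by (simp add: G_def h_def u_def)
  qed
  thus "(\<lambda>n::nat. caputo \<alpha> y x
              - (1 / (Gamma (2 - \<alpha>) * (x / real n) powr \<alpha>)) *
                (\<Sum>k = 0..n. delta_coef \<alpha> n k * y (x - real k * (x / real n))))
           \<in> O(\<lambda>n. (x / real n) ^ 2)"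
    by (intro bigoI[of _ K] eventually_sequentiallyI[of 2]) blast
qed

end
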